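(* Let $\mathcal K$ be the set of odd positive integers $k$ such that the sequence $(2^n k+1)_{n\ge 0}$ contains some Carmichael number. Then the smallest element of $\mathcal K$ is $27$.
   Context: A Carmichael number is a composite positive integer $N$ such that $a^N\equiv a\pmod N$ for all integers $a$. *)

theory Defs
  imports "HOL-Number_Theory.Number_Theory"
begin

definition carmichael :: "nat \<Rightarrow> bool" where
  "carmichael N \<longleftrightarrow> N > 1 \<and> \<not> prime N \<and> (\<forall>a::int. [a ^ N = a] (mod int N))"

definition carmichael_multipliers :: "nat set" where
  "carmichael_multipliers = {k. odd k \<and> (\<exists>n::nat. carmichael (2 ^ n * k + 1))}"

end

theory Submission
  imports Defs
begin

text \<open>
  Let \<open>N = 2\<^sup>n k + 1\<close> be a Carmichael number with \<open>k\<close> odd. By Korselt's criterion \<open>N\<close> is a product of distinct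
  primes \<open>2\<^sup>l d + 1\<close> with \<open>d\<close> dividing \<open>k\<close>; call \<open>l\<close> the level of the prime. As \<open>N \<equiv> 1\<close> modulo \<open>2\<^sup>n\<close>, the
  product of all prime factors of level less than \<open>L\<close> is congruent to \<open>1\<close> modulo \<open>2\<^sup>L\<close> for every \<open>L \<le> n\<close>.
  So the set of prime factors of level \<open>L\<close> is a choice of divisors of \<open>k\<close> subject to a parity condition that
  depends on the lower levels, and one can search the tree of all choices.

  Many choices are ruled out because \<open>2\<^sup>l d + 1\<close> has a fixed small prime factor \<open>r\<close> for all \<open>l\<close> in a
  residue class. A factor \<open>2\<^sup>l + 1\<close> is possible only if \<open>2\<^sup>l < 2k\<close>, since \<open>2\<^sup>l \<equiv> -1\<close> turns
  \<open>2\<^sup>n k \<equiv> -1\<close> into \<open>k \<equiv> \<plusminus>2\<^sup>M\<close> for some \<open>M < l\<close>. If \<open>k \<le> 25\<close> is \<open>1\<close>, a prime or \<open>25\<close>, then the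
  lowest level must be small, because at most one divisor is available at large levels while parity demands two.
  For \<open>k = 9, 15, 21\<close> and a large lowest level \<open>m\<close> the search is linear modulo \<open>2^(2m)\<close> and depends only
  on \<open>m mod 60\<close>, once one knows that the order of \<open>2\<close> modulo a factor \<open>2\<^sup>l k + 1\<close> is a multiple of \<open>4\<close>
  dividing \<open>n - l\<close>, so that all such levels agree modulo \<open>4\<close>.
\<close>

section \<open>Carmichael numbers and orders of two\<close>

lemma carmichael_odd:
  assumes "carmichael N" shows "odd N"
proof
  assume "even N"
  have "[(-1::int) ^ N = -1] (mod int N)" using assms by (simp add: carmichael_def)
  then have "int N dvd 2" using \<open>even N\<close> by (simp add: cong_iff_dvd_diff)
  then have "N dvd 2" by presburger
  then have "N \<le> 2" by (auto dest: dvd_imp_le)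
  moreover have "N > 1" "\<not> prime N" using assms by (auto simp: carmichael_def)
  ultimately have "N = 2" by simp
  with \<open>\<not> prime N\<close> show False by simp
qed

lemma carmichael_squarefree:
  assumes "carmichael N" "prime p" shows "\<not> p\<^sup>2 dvd N"
proof
  assume dv: "p\<^sup>2 dvd N"
  have "N > 1" "[int p ^ N = int p] (mod int N)" using assms by (auto simp: carmichael_def)
  then have "int N dvd int p ^ N - int p" by (simp add: cong_iff_dvd_diff)
  moreover have "int (p\<^sup>2) dvd int N" using dv by (simp only: int_dvd_int_iff)
  ultimately have "int p ^ 2 dvd int p ^ N - int p" by (metis dvd_trans of_nat_power)
  moreover have "int p ^ 2 dvd int p ^ N" using \<open>N > 1\<close> by (intro le_imp_power_dvd) simp
  ultimately have "int p ^ 2 dvd int p" by (metis dvd_diff_right_iff dvd_minus_iff minus_diff_eq)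
  then have "p ^ 2 dvd p" by (metis of_nat_dvd_iff of_nat_power)
  then have "p ^ 2 \<le> p" using assms(2) by (intro dvd_imp_le) (auto simp: prime_gt_0_nat)
  with prime_gt_1_nat[OF assms(2)] show False by (simp add: power2_eq_square)
qed

text \<open>Testing the defining congruence at a primitive root \<open>g\<close> modulo
  \<open>p\<close> makes the order of \<open>g\<close>, which is \<open>p - 1\<close>, divide
  \<open>N - 1\<close>.\<close>

lemma carmichael_prime_dvd:
  assumes "carmichael N" "prime p" "p dvd N" shows "p - 1 dvd N - 1"
proof -
  obtain g where g: "residue_primroot p g"
    using prime_primitive_root_exists assms(2) prime_gt_1_nat residue_primroot_def by blast
  then have co: "coprime p g" and o: "ord p g = totient p" by (auto simp: residue_primroot_def)
  have "N > 1" "[int g ^ N = int g] (mod int N)" using assms by (auto simp: carmichael_def)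
  then have "[int g ^ N = int g] (mod int p)" using assms(3) by (meson cong_dvd_modulus int_dvd_int_iff)
  then have "[g ^ N = g] (mod p)" by (metis cong_int_iff of_nat_power)
  moreover have "g ^ N = g * g ^ (N - 1)" using \<open>N > 1\<close> by (metis Suc_diff_1 less_trans power_Suc zero_less_one)
  ultimately have "[g * g ^ (N - 1) = g * 1] (mod p)" by simp
  then have "[g ^ (N - 1) = 1] (mod p)" using co by (metis cong_mult_lcancel_nat coprime_commute)
  then have "ord p g dvd N - 1" by (simp add: ord_divides')
  with o show ?thesis using assms(2) by (simp add: totient_prime)
qed

lemma carmichaelI:
  assumes "N > 1" "\<not> prime N" "finite S" "N = \<Prod>S"
    and "\<And>p. p \<in> S \<Longrightarrow> prime p \<and> p - 1 dvd N - 1"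
  shows "carmichael N"
  unfolding carmichael_def
proof (intro conjI allI)
  fix a :: int
  have fermat: "[a ^ N = a] (mod int p)" if "p \<in> S" for p
  proof (cases "int p dvd a")
    case True
    then have "int p dvd a ^ N" using assms(1) by (metis dvd_power dvd_trans less_trans zero_less_one)
    with True show ?thesis by (metis cong_0_iff cong_sym cong_trans)
  next
    case False
    have p: "prime p" "p - 1 dvd N - 1" using assms(5)[OF that] by auto
    then obtain q where q: "N - 1 = (p - 1) * q" by (elim dvdE)
    define b where "b = nat (a mod int p)"
    have b: "[int b = a] (mod int p)" using p prime_gt_0_nat[of p] by (simp add: b_def cong_def)
    then have "\<not> p dvd b" using False by (metis cong_dvd_iff int_dvd_int_iff)
    then have "[b ^ (p - 1) = 1] (mod p)" using p fermat_theorem by blast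
    then have "[(b ^ (p - 1)) ^ q = 1 ^ q] (mod p)" by (rule cong_pow)
    then have "[b ^ (N - 1) = 1] (mod p)" unfolding q power_mult by simp
    then have "[b * b ^ (N - 1) = b * 1] (mod p)" by (rule cong_scalar_left)
    moreover have "b * b ^ (N - 1) = b ^ N" using assms(1)
      by (metis Suc_diff_1 less_trans power_Suc zero_less_one)
    ultimately have "[b ^ N = b] (mod p)" by simp
    then have "[int b ^ N = int b] (mod int p)" by (metis cong_int_iff of_nat_power)
    moreover have "[int b ^ N = a ^ N] (mod int p)" using b by (rule cong_pow)
    ultimately show ?thesis using b by (meson cong_sym cong_trans)
  qed
  have "[a ^ N = a] (mod (\<Prod>p\<in>S. int p))"
    by (rule cong_cong_prod_coprime) (auto simp: fermat assms(5) primes_coprime)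
  then show "[a ^ N = a] (mod int N)" using assms(4) by simp
qed (use assms in auto)

section \<open>Prime factors and powers of two\<close>

lemma fermat_factor_bound:
  fixes k l n :: nat
  assumes "(2 ^ l + 1) dvd (2 ^ n * k + 1)" "l > 0" "odd k" "k > 1"
  shows "2 ^ l < 2 * k"
proof -
  define F where "F = (2 ^ l + 1 :: int)"
  \<comment> \<open>\<open>M\<close> is the least shift that makes \<open>n + M\<close> a multiple
    of \<open>l\<close>; multiplying by \<open>2 ^ M\<close> then turns \<open>2 ^ n\<close> into a
    power of \<open>2 ^ l\<close>, which is -1 modulo \<open>F\<close>.\<close>
  define M where "M = (l - n mod l) mod l"
  have M: "M < l" using assms(2) by (simp add: M_def)
  have "l dvd n + M"
  proof -
    have "(n + M) mod l = (n mod l + (l - n mod l)) mod l" unfolding M_def by (simp add: mod_simps)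
    also have "\<dots> = 0" using assms(2) by (simp add: less_imp_le)
    finally show ?thesis by auto
  qed
  then obtain q where q: "n + M = l * q" by (elim dvdE)
  have P: "(2::int) ^ M \<le> 2 ^ (l - 1)" using M by (intro power_increasing) auto
  have l2: "(2::int) ^ l = 2 * 2 ^ (l - 1)" using assms(2) by (metis power_eq_if not_gr_zero)
  have "int (2 ^ l + 1) dvd int (2 ^ n * k + 1)" using assms(1) by (simp only: int_dvd_int_iff)
  then have "F dvd 2 ^ n * int k + 1" by (simp add: F_def add.commute)
  then have "F dvd 2 ^ M * (2 ^ n * int k + 1)" by simp
  also have "2 ^ M * (2 ^ n * int k + 1) = (2 ^ l) ^ q * int k + 2 ^ M"
    by (simp add: algebra_simps flip: power_add power_mult q)
  finally have "[(2 ^ l) ^ q * int k + 2 ^ M = 0] (mod F)" by (simp add: cong_0_iff)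
  moreover have "[(2 ^ l) ^ q * int k + 2 ^ M = (- 1) ^ q * int k + 2 ^ M] (mod F)"
    by (intro cong_add cong_mult cong_pow) (auto simp: F_def cong_iff_dvd_diff)
  ultimately have *: "F dvd (- 1) ^ q * int k + 2 ^ M"
    by (metis cong_0_iff cong_sym cong_trans)
  show ?thesis
  proof (cases "even q")
    case True
    then have "F dvd int k + 2 ^ M" using * by simp
    then have "F \<le> int k + 2 ^ M" by (rule zdvd_imp_le) (simp add: add_nonneg_pos)
    then have "2 ^ l < 2 * int k" using P l2 unfolding F_def by linarith
    then show ?thesis by (metis of_nat_less_iff of_nat_mult of_nat_numeral of_nat_power)
  next
    case False
    then have d: "F dvd int k - 2 ^ M" using * by (simp add: dvd_diff_commute)
    \<comment> \<open>The difference must be nonzero before divisibility by \<open>F\<close> can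
      bound its size.\<close>
    have "int k \<noteq> 2 ^ M"
    proof
      assume "int k = 2 ^ M"
      then have "k = 2 ^ M" by (metis of_nat_eq_iff of_nat_numeral of_nat_power)
      then show False using assms(3,4) by (cases M) auto
    qed
    then have "\<bar>F\<bar> \<le> \<bar>int k - 2 ^ M\<bar>" using d by (intro dvd_imp_le_int) auto
    moreover have "(2::int) ^ M > 0" "(2::int) ^ (l - 1) > 0" by simp_all
    ultimately have "2 ^ l < 2 * int k" using P l2 unfolding F_def by linarith
    then show ?thesis by (metis of_nat_less_iff of_nat_mult of_nat_numeral of_nat_power)
  qed
qed

text \<open>The order of 2 modulo the prime divides \<open>2 ^ l * k\<close>. If 4 did not divide
  it, it would divide \<open>2 * k\<close>, and the prime would be less than
  \<open>2 ^ (2 * k) \<le> 2 ^ l\<close>. So 4 divides the order, which divides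
  \<open>n - l\<close>.\<close>

lemma order_level_cong:
  fixes k l n :: nat
  assumes p: "prime (2 ^ l * k + 1)" and dv: "(2 ^ l * k + 1) dvd (2 ^ n * k + 1)"
    and "odd k" "l \<le> n" "2 * k \<le> l"
  shows "n mod 4 = l mod 4"
proof -
  define p where "p = 2 ^ l * k + 1"
  have p1: "prime p" using p by (simp add: p_def)
  have k0: "k > 0" using assms(3) by (rule odd_pos)
  have l0: "l > 0" using assms(5) k0 by simp
  have "p dvd (2 ^ n * k + 1) - p" by (rule dvd_diff_nat) (use dv in \<open>simp_all add: p_def\<close>)
  also have "(2 ^ n * k + 1) - p = (2 ^ l * k) * (2 ^ (n - l) - 1)"
    using assms(4) by (simp add: p_def algebra_simps flip: power_add)
  finally have "p dvd (2 ^ l * k) * (2 ^ (n - l) - 1)" .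
  moreover have "coprime p (2 ^ l * k)" using coprime_Suc_left_nat[of "2 ^ l * k"] by (simp add: p_def)
  ultimately have "p dvd 2 ^ (n - l) - 1" by (simp add: coprime_dvd_mult_right_iff)
  then have "[2 ^ (n - l) = 1] (mod p)" by (simp add: cong_altdef_nat)
  then have o1: "ord p 2 dvd n - l" by (simp add: ord_divides')
  have "coprime p 2" using p1 l0 by (simp add: p_def)
  then have o2: "ord p 2 dvd 2 ^ l * k"
    using order_divides_totient[of p 2] p1 by (simp add: totient_prime p_def)
  have "4 dvd ord p 2"
  proof (rule ccontr)
    assume "\<not> 4 dvd ord p 2"
    have "ord p 2 dvd 2 * k"
    proof (cases "even (ord p 2)")
      case True
      then obtain j where j: "ord p 2 = 2 * j" by (elim evenE)
      with \<open>\<not> 4 dvd ord p 2\<close> have "odd j" by auto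
      then have "coprime j (2 ^ l)" by simp
      moreover have "j dvd 2 ^ l * k" using o2 j by (metis dvd_mult_right)
      ultimately have "j dvd k" by (simp add: coprime_dvd_mult_right_iff)
      with j show ?thesis by simp
    next
      case False
      then have "coprime (ord p 2) (2 ^ l)" by simp
      then show ?thesis using o2 by (simp add: coprime_dvd_mult_right_iff)
    qed
    then have "[2 ^ (2 * k) = 1] (mod p)" by (simp add: ord_divides')
    then have "p dvd 2 ^ (2 * k) - 1" by (simp add: cong_altdef_nat)
    moreover have "(2::nat) ^ (2 * k) > 1" using k0 by (intro one_less_power) auto
    ultimately have "p \<le> 2 ^ (2 * k) - 1" by (intro dvd_imp_le) auto
    moreover have "(2::nat) ^ (2 * k) \<le> 2 ^ l" using assms(5) by (intro power_increasing) auto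
    moreover have "2 ^ l \<le> 2 ^ l * k" using k0 by simp
    ultimately show False unfolding p_def by linarith
  qed
  then have "4 dvd n - l" using o1 by (rule dvd_trans)
  then show ?thesis using assms(4) by (metis mod_eq_dvd_iff_nat)
qed

section \<open>Prime factors by level\<close>

locale carmichael_form =
  fixes k n :: nat
  assumes odd_k: "odd k" and carm: "carmichael (2 ^ n * k + 1)"
begin

definition N :: nat where "N = 2 ^ n * k + 1"

definition multipliers :: "nat \<Rightarrow> nat set" where
  "multipliers L = {d. d dvd k \<and> prime (2 ^ L * d + 1) \<and> 2 ^ L * d + 1 dvd N}"

definition low_part :: "nat \<Rightarrow> nat" where
  "low_part L = (\<Prod>p \<in> {p \<in> prime_factors N. \<not> 2 ^ L dvd p - 1}. p)"

lemma carm_N: "carmichael N"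
  using carm by (simp add: N_def)

lemma N_pos: "N > 0" and not_prime_N: "\<not> prime N"
  using carm_N by (auto simp: carmichael_def)

lemma k_pos: "k > 0"
  using odd_k by (rule odd_pos)

lemma prod_prime_factors_N: "\<Prod>(prime_factors N) = N"
proof -
  have "N = (\<Prod>p\<in>prime_factors N. p ^ multiplicity p N)"
    using N_pos by (simp add: prime_factorization_nat)
  also have "\<dots> = (\<Prod>p\<in>prime_factors N. p)"
  proof (rule prod.cong)
    fix p assume p: "p \<in> prime_factors N"
    then have "p dvd N" "prime p" by (auto simp: in_prime_factors_iff)
    moreover have "\<not> 2 \<le> multiplicity p N"
      using carmichael_squarefree[OF carm_N \<open>prime p\<close>] multiplicity_dvd' by blast
    ultimately have "multiplicity p N = 1"
      using N_pos prime_multiplicity_gt_zero_iff[of p N] by simp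
    then show "p ^ multiplicity p N = p" by simp
  qed simp
  finally show ?thesis by simp
qed

lemma prime_factorsD:
  assumes "p \<in> prime_factors N"
  shows "prime p" "p dvd N" "odd p" "p - 1 dvd 2 ^ n * k" "p > 2"
proof -
  show p: "prime p" "p dvd N" using assms by auto
  show "odd p" using p(2) carmichael_odd[OF carm_N] by (metis dvd_trans)
  with p(1) show "p > 2" using prime_ge_2_nat[of p] by (cases "p = 2") auto
  show "p - 1 dvd 2 ^ n * k" using carmichael_prime_dvd[OF carm_N p] by (simp add: N_def)
qed

lemma finite_multipliers: "finite (multipliers L)"
  by (rule finite_subset[of _ "{d. d dvd k}"]) (use k_pos in \<open>auto simp: multipliers_def\<close>)

text \<open>The odd part of \<open>p - 1\<close> divides \<open>2 ^ n * k\<close> and is coprime to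
  \<open>2 ^ n\<close>, hence divides \<open>k\<close>. So \<open>multipliers L\<close> records
  exactly the prime factors of level \<open>L\<close>.\<close>

lemma level_eq:
  "{p \<in> prime_factors N. 2 ^ L dvd p - 1 \<and> \<not> 2 ^ Suc L dvd p - 1} = (\<lambda>d. 2 ^ L * d + 1) ` multipliers L"
  (is "?A = ?B")
proof
  show "?A \<subseteq> ?B"
  proof
    fix p assume "p \<in> ?A"
    then have p: "p \<in> prime_factors N" "2 ^ L dvd p - 1" "\<not> 2 ^ Suc L dvd p - 1" by auto
    then obtain d where d: "p - 1 = 2 ^ L * d" by (elim dvdE)
    with p(3) have "odd d" by auto
    then have "coprime d (2 ^ n)" by simp
    moreover have "d dvd 2 ^ n * k" using prime_factorsD(4)[OF p(1)] d by (metis dvd_mult_right)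
    ultimately have "d dvd k" by (simp add: coprime_dvd_mult_right_iff)
    moreover have "p = 2 ^ L * d + 1" using d prime_factorsD(5)[OF p(1)] by simp
    ultimately show "p \<in> ?B" using prime_factorsD(1,2)[OF p(1)]
      unfolding multipliers_def by blast
  qed
  show "?B \<subseteq> ?A"
  proof
    fix p assume "p \<in> ?B"
    then obtain d where d: "d dvd k" "prime p" "p dvd N" "p = 2 ^ L * d + 1"
      unfolding multipliers_def by blast
    have "odd d" using d(1) odd_k by (metis dvd_trans)
    then show "p \<in> ?A" using d N_pos by (auto simp: in_prime_factors_iff)
  qed
qed

lemma low_part_Suc: "low_part (Suc L) = low_part L * (\<Prod>d\<in>multipliers L. 2 ^ L * d + 1)"
proof -
  let ?A = "{p \<in> prime_factors N. \<not> 2 ^ L dvd p - 1}"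
  let ?B = "{p \<in> prime_factors N. 2 ^ L dvd p - 1 \<and> \<not> 2 ^ Suc L dvd p - 1}"
  have "{p \<in> prime_factors N. \<not> 2 ^ Suc L dvd p - 1} = ?A \<union> ?B"
    by (auto dest: power_le_dvd[of _ "Suc L" _ L])
  then have "low_part (Suc L) = \<Prod>(?A \<union> ?B)" by (simp add: low_part_def)
  also have "\<dots> = \<Prod>?A * \<Prod>?B" by (rule prod.union_disjoint) auto
  also have "\<Prod>?B = (\<Prod>d\<in>multipliers L. 2 ^ L * d + 1)"
    unfolding level_eq by (subst prod.reindex) (auto simp: inj_on_def)
  finally show ?thesis by (simp add: low_part_def)
qed

text \<open>Both \<open>N\<close> and all its prime factors of level at least \<open>L\<close> are 1
  modulo \<open>2 ^ L\<close>, so the product of the others is as well.\<close>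

lemma low_part_cong:
  assumes "L \<le> n" shows "[low_part L = 1] (mod 2 ^ L)"
proof -
  let ?A = "{p \<in> prime_factors N. \<not> 2 ^ L dvd p - 1}"
  let ?B = "{p \<in> prime_factors N. 2 ^ L dvd p - 1}"
  have "low_part L * \<Prod>?B = \<Prod>(?A \<union> ?B)"
    unfolding low_part_def by (rule prod.union_disjoint[symmetric]) auto
  also have "?A \<union> ?B = prime_factors N" by auto
  finally have N: "low_part L * \<Prod>?B = N" by (simp only: prod_prime_factors_N)
  have "[(\<Prod>p\<in>?B. p) = (\<Prod>p\<in>?B. 1)] (mod 2 ^ L)"
  proof (rule cong_prod)
    fix p assume "p \<in> ?B"
    then have "2 ^ L dvd p - 1" "p > 2" using prime_factorsD(5) by auto
    then show "[p = 1] (mod 2 ^ L)" by (simp add: cong_altdef_nat)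
  qed
  then have "[low_part L * \<Prod>?B = low_part L * 1] (mod 2 ^ L)" by (intro cong_mult) auto
  then have "[N = low_part L * 1] (mod 2 ^ L)" unfolding N .
  moreover have "[N = 1] (mod 2 ^ L)"
    using assms by (auto simp: N_def cong_altdef_nat intro: dvd_mult2 le_imp_power_dvd)
  ultimately show ?thesis by (metis cong_sym cong_trans mult.right_neutral)
qed

lemma low_part_1: "low_part (Suc 0) = 1"
proof -
  have "{p \<in> prime_factors N. \<not> 2 ^ Suc 0 dvd p - 1} = {}" using prime_factorsD(3) by auto
  then show ?thesis unfolding low_part_def by (simp only: prod.empty)
qed

lemma low_part_Suc_n: "low_part (Suc n) = N"
proof -
  have "\<not> 2 ^ Suc n dvd p - 1" if "p \<in> prime_factors N" for p
  proof
    assume "2 ^ Suc n dvd p - 1"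
    then have "2 ^ n * 2 dvd 2 ^ n * k" using prime_factorsD(4)[OF that] by (simp add: mult.commute dvd_trans)
    then show False using odd_k by simp
  qed
  then have "{p \<in> prime_factors N. \<not> 2 ^ Suc n dvd p - 1} = prime_factors N" by auto
  then show ?thesis using prod_prime_factors_N by (simp add: low_part_def)
qed

lemma obtain_first_level:
  obtains m where "0 < m" "m \<le> n" "low_part m = 1" "multipliers m \<noteq> {}"
proof -
  \<comment> \<open>The lowest level of a prime factor; the minimum exists because
    \<open>low_part (Suc n)\<close> is \<open>N\<close>.\<close>
  define m where "m = (LEAST L. low_part (Suc L) \<noteq> 1)"
  have ex: "low_part (Suc n) \<noteq> 1" using low_part_Suc_n carm_N by (auto simp: carmichael_def)
  have m: "low_part (Suc m) \<noteq> 1" unfolding m_def by (rule LeastI[of "\<lambda>L. low_part (Suc L) \<noteq> 1", OF ex])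
  have "m \<le> n" unfolding m_def by (rule Least_le) (rule ex)
  have "m > 0" using m low_part_1 by (cases m) auto
  moreover have "low_part m = 1"
    using not_less_Least[of "m - 1" "\<lambda>L. low_part (Suc L) \<noteq> 1", folded m_def] \<open>m > 0\<close> by simp
  moreover have "multipliers m \<noteq> {}"
    using m low_part_Suc[of m] \<open>low_part m = 1\<close> by auto
  ultimately show ?thesis using that \<open>m \<le> n\<close> by blast
qed

lemma multipliersD:
  assumes "d \<in> multipliers L"
  shows "d dvd k" "odd d" "d > 0" "prime (2 ^ L * d + 1)" "2 ^ L * d + 1 dvd N"
proof -
  show d: "d dvd k" "prime (2 ^ L * d + 1)" "2 ^ L * d + 1 dvd N" using assms by (auto simp: multipliers_def)
  show "odd d" using d(1) odd_k by (metis dvd_trans)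
  then show "d > 0" by (rule odd_pos)
qed

lemma top_multiplier: "k \<notin> multipliers n"
  using multipliersD(4)[of k n] not_prime_N by (auto simp: N_def)

lemma level_le_n:
  assumes "d \<in> multipliers L" shows "L \<le> n"
proof (rule ccontr)
  assume "\<not> L \<le> n"
  have "2 ^ L * d + 1 \<in> prime_factors N"
    using multipliersD(4,5)[OF assms] N_pos by (simp add: in_prime_factors_iff)
  then have "2 ^ L * d dvd 2 ^ n * k" using prime_factorsD(4) by fastforce
  then have "2 ^ L dvd 2 ^ n * k" by (rule dvd_mult_left)
  moreover have "2 ^ Suc n dvd (2::nat) ^ L" using \<open>\<not> L \<le> n\<close> by (intro le_imp_power_dvd) simp
  ultimately have "2 ^ n * 2 dvd 2 ^ n * k" by (metis dvd_trans power_Suc2)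
  then show False using odd_k by simp
qed

text \<open>\<open>N\<close> is composite, so it is divisible by a product of two primes exceeding
  \<open>2 ^ m\<close>. This keeps \<open>n\<close> from being much below \<open>2 * m\<close> and
  leaves room for the search modulo \<open>2 ^ (2 * m)\<close>.\<close>

lemma first_level_bound:
  assumes "low_part m = 1" "0 < m"
  shows "2 ^ (2 * m) < 2 ^ n * k"
proof -
  have big: "2 ^ m < p" if "p \<in> prime_factors N" for p
  proof -
    have "{p \<in> prime_factors N. \<not> 2 ^ m dvd p - 1} = {}"
    proof (rule ccontr)
      assume "{p \<in> prime_factors N. \<not> 2 ^ m dvd p - 1} \<noteq> {}"
      then obtain q where q: "q \<in> {p \<in> prime_factors N. \<not> 2 ^ m dvd p - 1}" by blast
      then have "q dvd low_part m" unfolding low_part_def by (intro dvd_prodI) auto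
      with assms(1) q prime_factorsD(5)[of q] show False by simp
    qed
    with that have "2 ^ m dvd p - 1" by blast
    moreover have "p - 1 > 0" using prime_factorsD(5)[OF that] by simp
    ultimately have "2 ^ m \<le> p - 1" by (intro dvd_imp_le) auto
    then show ?thesis using \<open>p - 1 > 0\<close> by linarith
  qed
  have "N \<noteq> 1" using carm_N by (auto simp: carmichael_def)
  then obtain p where p: "prime p" "p dvd N" using prime_factor_nat by blast
  then obtain c where c: "N = p * c" by (elim dvdE)
  have "c \<noteq> 1" using c p not_prime_N by auto
  then obtain q where q: "prime q" "q dvd c" using prime_factor_nat by blast
  have "p * q dvd N" using c q by simp
  then have "p * q \<le> N" using N_pos by (rule dvd_imp_le)
  moreover have "p \<in> prime_factors N" "q \<in> prime_factors N"
    using p q c N_pos by (auto simp: in_prime_factors_iff)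
  then have "2 ^ m + 1 \<le> p" "2 ^ m + 1 \<le> q" using big by (auto simp: Suc_le_eq)
  then have "(2 ^ m + 1) * (2 ^ m + 1) \<le> p * q" by (rule mult_le_mono)
  moreover have "(2 ^ m + 1) * (2 ^ m + 1) = (2::nat) ^ (2 * m) + 2 * 2 ^ m + 1"
    by (simp add: power_add mult_2)
  moreover have "(2::nat) ^ m > 0" by simp
  ultimately show ?thesis unfolding N_def by linarith
qed

end

section \<open>Searching the tree of choices\<close>

text \<open>A product \<open>1 + Y c\<close> of factors \<open>1 + Y d\<close> is encoded by \<open>c\<close>; the value \<open>Y = 0\<close> gives plain sums.\<close>

primrec extend :: "nat \<Rightarrow> nat list \<Rightarrow> nat \<Rightarrow> nat list" where
  "extend Y [] b = [b]"
| "extend Y (d # ds) b = extend Y ds b @ extend Y ds (b + d + Y * b * d)"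

lemma extend_complete:
  assumes "distinct A" "S \<subseteq> set A"
  shows "\<exists>c \<in> set (extend Y A b). (1 + Y * b) * (\<Prod>d\<in>S. Y * d + 1) = 1 + Y * c"
  using assms
proof (induction A arbitrary: b S)
  case (Cons a A)
  show ?case
  proof (cases "a \<in> S")
    case True
    have "S - {a} \<subseteq> set A" using Cons.prems by auto
    then obtain c where c: "c \<in> set (extend Y A (b + a + Y * b * a))"
      "(1 + Y * (b + a + Y * b * a)) * (\<Prod>d\<in>S - {a}. Y * d + 1) = 1 + Y * c"
      using Cons.IH Cons.prems(1) by (meson distinct.simps(2))
    have "finite S" using Cons.prems(2) by (rule finite_subset) simp
    then have "(\<Prod>d\<in>S. Y * d + 1) = (Y * a + 1) * (\<Prod>d\<in>S - {a}. Y * d + 1)"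
      using True by (rule prod.remove)
    moreover have "(1 + Y * b) * (Y * a + 1) = 1 + Y * (b + a + Y * b * a)"
      by (simp add: algebra_simps)
    ultimately have "(1 + Y * b) * (\<Prod>d\<in>S. Y * d + 1) = 1 + Y * c"
      using c(2) by (metis mult.assoc)
    with c(1) show ?thesis by auto
  next
    case False
    then have "S \<subseteq> set A" using Cons.prems by auto
    then obtain c where "c \<in> set (extend Y A b)" "(1 + Y * b) * (\<Prod>d\<in>S. Y * d + 1) = 1 + Y * c"
      using Cons.IH Cons.prems(1) by (meson distinct.simps(2))
    then show ?thesis by auto
  qed
qed simp

text \<open>For \<open>Y = 0\<close> the identity of \<open>extend_complete\<close> reads 1 = 1, so
  sums need their own induction.\<close>

lemma extend_0_complete:
  assumes "distinct A" "S \<subseteq> set A"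
  shows "b + \<Sum>S \<in> set (extend 0 A b)"
  using assms
proof (induction A arbitrary: b S)
  case (Cons a A)
  show ?case
  proof (cases "a \<in> S")
    case True
    have "S - {a} \<subseteq> set A" using Cons.prems by auto
    then have "b + a + \<Sum>(S - {a}) \<in> set (extend 0 A (b + a))" using Cons.IH Cons.prems(1) by auto
    moreover have "finite S" using Cons.prems(2) by (rule finite_subset) simp
    then have "\<Sum>S = a + \<Sum>(S - {a})" using True by (rule sum.remove)
    ultimately show ?thesis by (simp add: add.assoc)
  next
    case False
    then have "S \<subseteq> set A" using Cons.prems by auto
    then show ?thesis using Cons.IH Cons.prems(1) by auto
  qed
qed simp

text \<open>
  The arguments are \<open>Y = 2\<^sup>L\<close> and \<open>b\<close>, where \<open>1 + Y b\<close> is the product of the prime factors of level less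
  than \<open>L\<close>; the list gives the divisors available at the levels \<open>L, L + 1, \<dots>\<close>. The first conjunct excludes
  \<open>L = n\<close>, where the factor with divisor \<open>k\<close> would be \<open>N\<close> itself. The conditional keeps the simplifier
  from unfolding the pruned branches. An exhausted list is accepted only if no prime has been chosen.
\<close>

primrec dead :: "nat \<Rightarrow> nat list list \<Rightarrow> nat \<Rightarrow> nat \<Rightarrow> bool" where
  "dead k [] Y b \<longleftrightarrow> b = 0"
| "dead k (A # As) Y b \<longleftrightarrow>
     k \<notin> set (extend Y (filter (\<lambda>d. d \<noteq> k) A) b) \<and>
     list_all (\<lambda>c. if odd c then True else dead k As (2 * Y) (c div 2)) (extend Y A b)"

text \<open>
  The same search with products taken modulo \<open>2^(2m)\<close> for levels \<open>L \<ge> m\<close>. The residue of \<open>n - L\<close> modulo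
  \<open>4\<close> is \<open>s\<close>, and the divisor \<open>k\<close> is allowed only if it vanishes.
\<close>

primrec mod_dead :: "nat \<Rightarrow> nat list list \<Rightarrow> nat \<Rightarrow> nat \<Rightarrow> bool" where
  "mod_dead k [] s b \<longleftrightarrow> False"
| "mod_dead k (A # As) s b \<longleftrightarrow>
     list_all (\<lambda>c. if c = 0 \<or> odd c then True else mod_dead k As (if s = 0 then 3 else s - 1) (c div 2))
       (extend 0 (if s = 0 then A else filter (\<lambda>d. d \<noteq> k) A) b)"

context carmichael_form begin

lemma low_part_Suc_even:
  assumes "low_part (Suc L) = 1 + 2 ^ L * c" "L < n" shows "even c"
proof -
  have "[1 + 2 ^ L * c = 1] (mod 2 ^ Suc L)"
    using low_part_cong[of "Suc L"] assms by simp
  then have "2 ^ L * 2 dvd 2 ^ L * c" by (simp add: cong_altdef_nat mult.commute)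
  then show ?thesis by simp
qed

lemma dead_sound:
  assumes "dead k As (2 ^ L) b"
    and "low_part L = 1 + 2 ^ L * b" "L \<le> n"
    and "\<And>i. i < length As \<Longrightarrow> distinct (As ! i) \<and> multipliers (L + i) \<subseteq> set (As ! i)"
  shows "low_part (L + length As) = 1 \<and> L + length As \<le> n"
  using assms
proof (induction As arbitrary: L b)
  case (Cons A As)
  have A: "distinct A" "multipliers L \<subseteq> set A" using Cons.prems(4)[of 0] by auto
  have step: "low_part (Suc L) = (1 + 2 ^ L * b) * (\<Prod>d\<in>multipliers L. 2 ^ L * d + 1)"
    using low_part_Suc Cons.prems(2) by simp
  \<comment> \<open>At level \<open>n\<close> the code of the low part becomes \<open>k\<close>,
    reached without the divisor \<open>k\<close> itself; the first conjunct of \<open>dead\<close>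
    forbids this.\<close>
  have "L \<noteq> n"
  proof
    assume "L = n"
    then have "multipliers L \<subseteq> set (filter (\<lambda>d. d \<noteq> k) A)" using A(2) top_multiplier by auto
    then obtain c where c: "c \<in> set (extend (2 ^ L) (filter (\<lambda>d. d \<noteq> k) A) b)" "low_part (Suc L) = 1 + 2 ^ L * c"
      using extend_complete[of "filter (\<lambda>d. d \<noteq> k) A" "multipliers L" "2 ^ L" b] A(1) step by auto
    then have "c = k" using low_part_Suc_n \<open>L = n\<close> by (simp add: N_def)
    with c(1) Cons.prems(1) show False by simp
  qed
  then have "L < n" using Cons.prems(3) by simp
  obtain c where c: "c \<in> set (extend (2 ^ L) A b)" "low_part (Suc L) = 1 + 2 ^ L * c"
    using extend_complete[OF A, of "2 ^ L" b] step by auto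
  have ev: "even c" using low_part_Suc_even[OF c(2) \<open>L < n\<close>] .
  then have "dead k As (2 ^ Suc L) (c div 2)"
    using Cons.prems(1) c(1) by (auto simp: list_all_iff)
  moreover have "low_part (Suc L) = 1 + 2 ^ Suc L * (c div 2)"
    using c(2) ev by (simp add: mult.assoc)
  ultimately have "low_part (Suc L + length As) = 1 \<and> Suc L + length As \<le> n"
    using Cons.prems(4)[of "Suc _"] \<open>L < n\<close> by (intro Cons.IH) auto
  then show ?case by simp
qed auto

text \<open>The actual factorization yields a branch whose codes are all even, by the parity
  condition, and nonzero, since a prime has been chosen; \<open>mod_dead\<close> leaves no such
  branch through the whole list.\<close>

lemma mod_dead_sound:
  assumes "mod_dead k As s b" "s < 4" "(L + s) mod 4 = n mod 4"
    and "[low_part L = 1 + 2 ^ L * b] (mod 2 ^ M)" "M \<le> 2 * L" "L + length As \<le> M" "L + length As \<le> n"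
    and "b \<noteq> 0 \<or> multipliers L \<noteq> {}"
    and "\<And>i. i < length As \<Longrightarrow> distinct (As ! i) \<and> multipliers (L + i) \<subseteq> set (As ! i)"
    and "\<And>l. L \<le> l \<Longrightarrow> k \<in> multipliers l \<Longrightarrow> n mod 4 = l mod 4"
  shows False
  using assms
proof (induction As arbitrary: L s b)
  case (Cons A As)
  have A: "distinct A" "multipliers L \<subseteq> set A" using Cons.prems(9)[of 0] by auto
  have L: "L < n" "L < M" using Cons.prems(6,7) by simp_all
  define A' where "A' = (if s = 0 then A else filter (\<lambda>d. d \<noteq> k) A)"
  define c where "c = b + \<Sum>(multipliers L)"
  have "k \<notin> multipliers L" if "s \<noteq> 0"
  proof
    assume "k \<in> multipliers L"
    then have "(L + s) mod 4 = L mod 4" using Cons.prems(3,10) by simp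
    then have "s mod 4 = 0" by presburger
    with that Cons.prems(2) show False by simp
  qed
  then have "distinct A'" "multipliers L \<subseteq> set A'" using A by (auto simp: A'_def)
  then have c: "c \<in> set (extend 0 A' b)" unfolding c_def by (rule extend_0_complete)
  have "c \<noteq> 0"
    using Cons.prems(8) finite_multipliers multipliersD(3) by (fastforce simp: c_def)
  \<comment> \<open>Cross terms carry the factor \<open>2 ^ (2 * L)\<close> and vanish modulo
    \<open>2 ^ M\<close>, so products become sums.\<close>
  have "[(1 + 2 ^ L * b) * (\<Prod>d\<in>S. 2 ^ L * d + 1) = 1 + 2 ^ L * (b + \<Sum>S)] (mod 2 ^ M)"
    if "finite S" for S
    using that
  proof (induction S)
    case (insert x S)
    have "(1 + 2 ^ L * b) * (\<Prod>d\<in>insert x S. 2 ^ L * d + 1)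
        = ((1 + 2 ^ L * b) * (\<Prod>d\<in>S. 2 ^ L * d + 1)) * (2 ^ L * x + 1)"
      using insert.hyps by (simp add: algebra_simps)
    also have "[\<dots> = (1 + 2 ^ L * (b + \<Sum>S)) * (2 ^ L * x + 1)] (mod 2 ^ M)"
      using insert.IH by (rule cong_scalar_right)
    also have "(1 + 2 ^ L * (b + \<Sum>S)) * (2 ^ L * x + 1)
        = 1 + 2 ^ L * (b + \<Sum>(insert x S)) + 2 ^ (2 * L) * ((b + \<Sum>S) * x)"
      using insert.hyps by (simp add: algebra_simps power_add mult_2_right)
    also have "[\<dots> = 1 + 2 ^ L * (b + \<Sum>(insert x S)) + 0] (mod 2 ^ M)"
      using Cons.prems(5) by (intro cong_add) (auto simp: cong_0_iff intro: dvd_mult2 le_imp_power_dvd)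
    finally show ?case by simp
  qed simp
  from this[OF finite_multipliers]
  have "[(1 + 2 ^ L * b) * (\<Prod>d\<in>multipliers L. 2 ^ L * d + 1) = 1 + 2 ^ L * c] (mod 2 ^ M)"
    by (simp add: c_def)
  then have step: "[low_part (Suc L) = 1 + 2 ^ L * c] (mod 2 ^ M)"
    unfolding low_part_Suc using Cons.prems(4) by (meson cong_scalar_right cong_trans)
  then have "[low_part (Suc L) = 1 + 2 ^ L * c] (mod 2 ^ Suc L)"
    by (rule cong_dvd_modulus_nat) (intro le_imp_power_dvd, use L in simp)
  moreover have "[low_part (Suc L) = 1] (mod 2 ^ Suc L)" using L low_part_cong[of "Suc L"] by (simp del: power_Suc)
  ultimately have "[1 + 2 ^ L * c = 1] (mod 2 ^ Suc L)" by (meson cong_sym cong_trans)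
  then have "2 ^ L * 2 dvd 2 ^ L * c" by (simp add: cong_altdef_nat mult.commute)
  then have ev: "even c" by simp
  \<comment> \<open>One level up, \<open>n - L\<close> drops by one modulo 4.\<close>
  let ?s = "if s = 0 then 3 else s - 1"
  have "mod_dead k As ?s (c div 2)"
    using Cons.prems(1) c ev \<open>c \<noteq> 0\<close> by (auto simp: list_all_iff A'_def split: if_splits)
  moreover have "?s < 4" "(Suc L + ?s) mod 4 = n mod 4"
    using Cons.prems(2,3) by (auto split: if_splits)
  moreover have "2 ^ L * c = 2 ^ Suc L * (c div 2)" using ev by (auto elim: evenE)
  then have "[low_part (Suc L) = 1 + 2 ^ Suc L * (c div 2)] (mod 2 ^ M)" using step by (simp only:)
  moreover have "c div 2 \<noteq> 0" using ev \<open>c \<noteq> 0\<close> by auto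
  ultimately show ?case
    using Cons.prems(5,6,7,10) Cons.prems(9)[of "Suc _"]
    by (intro Cons.IH[of ?s "c div 2" "Suc L"]) auto
qed simp

end

section \<open>Coverings\<close>

text \<open>
  An entry \<open>(r, t, a, s)\<close> for \<open>d\<close> says that \<open>2\<^sup>l d + 1\<close>, for \<open>l \<ge> s\<close> congruent to \<open>a\<close> modulo \<open>t\<close>, is
  divisible by \<open>r\<close> and is not a prime factor of \<open>N\<close>: either it exceeds \<open>r\<close>, or \<open>r\<close> never divides
  \<open>2\<^sup>j k + 1\<close>. The numerical entries below were found by a computer search.
\<close>

type_synonym cover = "(nat \<times> (nat \<times> nat \<times> nat \<times> nat) list) list"

definition covering :: "nat \<Rightarrow> nat \<Rightarrow> nat \<times> nat \<times> nat \<times> nat \<Rightarrow> bool" where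
  "covering k d = (\<lambda>(r, t, a, s). 1 < r \<and> 0 < t \<and> 2 ^ t mod r = 1 \<and> (2 ^ a * d + 1) mod r = 0 \<and>
     (if r < 2 ^ s * d + 1 then True else list_all (\<lambda>j. (2 ^ j * k + 1) mod r \<noteq> 0) [0..<t]))"

definition valid_cover :: "nat \<Rightarrow> cover \<Rightarrow> bool" where
  "valid_cover k cov \<longleftrightarrow> distinct (map fst cov) \<and>
     list_all (\<lambda>d. d dvd k \<longrightarrow> d \<in> set (map fst cov)) [1..<k + 1] \<and>
     list_all (\<lambda>(d, rs). list_all (covering k d) rs) cov"

definition sieve :: "cover \<Rightarrow> nat \<Rightarrow> nat list" where
  "sieve cov l = map fst (filter (\<lambda>(d, rs). list_all (\<lambda>(r, t, a, s). \<not> (s \<le> l \<and> l mod t = a)) rs) cov)"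

text \<open>The condition on the divisor 1 is the one from
  \<open>fermat_factor_bound\<close>.\<close>

definition candidates :: "nat \<Rightarrow> cover \<Rightarrow> nat \<Rightarrow> nat list" where
  "candidates k cov l = filter (\<lambda>d. d = 1 \<longrightarrow> 2 ^ l < 2 * k) (sieve cov l)"

text \<open>The threshold \<open>42 = 2 \<cdot> 21\<close> is where the congruence modulo \<open>4\<close> is available for all \<open>k \<le> 21\<close>.\<close>

definition periodic_part :: "cover \<Rightarrow> cover" where
  "periodic_part cov = map (\<lambda>(d, rs). (d, filter (\<lambda>(r, t, a, s). t dvd 60 \<and> s \<le> 42) rs))
     (filter (\<lambda>(d, rs). d \<noteq> 1) cov)"

text \<open>Here \<open>a\<close> and \<open>s\<close> stand for the lowest level \<open>m\<close>
  modulo 60 and for \<open>n - m\<close> modulo 4. It is applied to 96 = 60 + 36 levels starting at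
  a multiple of 60, so each \<open>a\<close> has a full window of 36 levels. For
  \<open>m \<ge> 42\<close> such a window stays below both \<open>2 * m\<close> and
  \<open>n\<close>.\<close>

definition mod_check :: "nat \<Rightarrow> nat list list \<Rightarrow> bool" where
  "mod_check k As \<longleftrightarrow>
     list_all (\<lambda>a. list_all (\<lambda>s. mod_dead k (take 36 (drop a As)) s 0) [0..<4]) [0..<60]"

section \<open>Soundness of the coverings and of the searches\<close>

context carmichael_form begin

lemma covering_sound:
  assumes "covering k d (r, t, a, s)" "d \<in> multipliers l" "s \<le> l" "l mod t = a"
  shows False
proof -
  have r: "1 < r" "0 < t" "[2 ^ t = 1] (mod r)" "r dvd 2 ^ a * d + 1"
    and c: "r < 2 ^ s * d + 1 \<or> (\<forall>j<t. \<not> r dvd 2 ^ j * k + 1)"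
    using assms(1) by (auto simp: covering_def cong_def list_all_iff dvd_eq_mod_eq_0 split: if_splits)
  have red: "[2 ^ x = 2 ^ (x mod t)] (mod r)" for x
  proof -
    have "(2::nat) ^ x = (2 ^ t) ^ (x div t) * 2 ^ (x mod t)"
      by (simp flip: power_mult power_add)
    also have "[\<dots> = 1 ^ (x div t) * 2 ^ (x mod t)] (mod r)"
      using r(3) by (intro cong_scalar_right cong_pow)
    finally show ?thesis by simp
  qed
  let ?p = "2 ^ l * d + 1"
  have "[?p = 2 ^ a * d + 1] (mod r)"
    using red[of l] assms(4) by (intro cong_add cong_scalar_right) auto
  then have "r dvd ?p" using r(4) by (simp add: cong_dvd_iff)
  \<comment> \<open>With \<open>r\<close> equal to the prime, the size alternative fails, so
    \<open>r\<close> divides no \<open>2 ^ j * k + 1\<close> and in particular not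
    \<open>N\<close>.\<close>
  then have rp: "r = ?p"
    using multipliersD(4)[OF assms(2)] r(1) by (auto simp: prime_nat_iff)
  have "2 ^ s * d \<le> 2 ^ l * d" using assms(3) by (intro mult_le_mono1 power_increasing) auto
  with rp c have "\<not> r dvd 2 ^ (n mod t) * k + 1" using r(2) by auto
  moreover have "[N = 2 ^ (n mod t) * k + 1] (mod r)"
    unfolding N_def using red[of n] by (intro cong_add cong_scalar_right) auto
  ultimately have "\<not> r dvd N" using cong_dvd_iff by blast
  then show False using multipliersD(5)[OF assms(2)] rp by simp
qed

lemma sieve_sound:
  assumes "valid_cover k cov"
  shows "distinct (sieve cov l)" "multipliers l \<subseteq> set (sieve cov l)"
proof -
  show "distinct (sieve cov l)"
    using assms unfolding sieve_def valid_cover_def by (simp add: distinct_map_filter)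
  show "multipliers l \<subseteq> set (sieve cov l)"
  proof
    fix d assume d: "d \<in> multipliers l"
    have "d \<in> set [1..<k + 1]"
      using multipliersD(1,3)[OF d] dvd_imp_le[OF multipliersD(1)[OF d] k_pos] by auto
    then have "d \<in> set (map fst cov)"
      using assms multipliersD(1)[OF d] unfolding valid_cover_def list_all_iff by blast
    then obtain rs where rs: "(d, rs) \<in> set cov" by auto
    then have "\<forall>c\<in>set rs. covering k d c"
      using assms unfolding valid_cover_def list_all_iff by fastforce
    then have "list_all (\<lambda>(r, t, a, s). \<not> (s \<le> l \<and> l mod t = a)) rs"
      using covering_sound[OF _ d] unfolding list_all_iff by blast
    with rs show "d \<in> set (sieve cov l)" unfolding sieve_def by force
  qed
qed

lemma candidates_sound:
  assumes "valid_cover k cov" "k > 1" "l > 0"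
  shows "distinct (candidates k cov l)" "multipliers l \<subseteq> set (candidates k cov l)"
proof -
  show "distinct (candidates k cov l)" using sieve_sound(1)[OF assms(1)] by (simp add: candidates_def)
  have "2 ^ l < 2 * k" if "1 \<in> multipliers l"
    using multipliersD(5)[OF that] fermat_factor_bound[of l n k] assms odd_k by (simp add: N_def)
  then show "multipliers l \<subseteq> set (candidates k cov l)"
    using sieve_sound(2)[OF assms(1), of l] by (auto simp: candidates_def)
qed

lemma periodic_part_sound:
  assumes "valid_cover k cov" "k > 1" "l \<ge> 42" "l' \<ge> 42" "[l = l'] (mod 60)" "2 * k \<le> 42"
  shows "distinct (sieve (periodic_part cov) l')" "multipliers l \<subseteq> set (sieve (periodic_part cov) l')"
proof -
  let ?F = "\<lambda>x. list_all (\<lambda>(r, t, a, s). \<not> (s \<le> x \<and> x mod t = a))"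
  have "distinct (map fst cov)" using assms(1) by (simp add: valid_cover_def)
  moreover have "map fst (periodic_part cov) = map fst (filter (\<lambda>(d, rs). d \<noteq> 1) cov)"
    by (simp add: periodic_part_def case_prod_unfold comp_def)
  ultimately have "distinct (map fst (periodic_part cov))" by (simp add: distinct_map_filter)
  then show "distinct (sieve (periodic_part cov) l')" by (simp add: sieve_def distinct_map_filter)
  show "multipliers l \<subseteq> set (sieve (periodic_part cov) l')"
  proof
    fix d assume d: "d \<in> multipliers l"
    then have dl: "d \<in> set (candidates k cov l)" using candidates_sound(2)[of cov l] assms by auto
    have "d \<noteq> 1"
    proof
      assume "d = 1"
      with dl have "2 ^ l < 2 * k" by (simp add: candidates_def)
      moreover have "l < 2 ^ l" by (rule less_exp)
      ultimately show False using assms(3,6) by simp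
    qed
    from dl obtain rs where rs: "(d, rs) \<in> set cov" "?F l rs" by (auto simp: candidates_def sieve_def)
    let ?rs = "filter (\<lambda>(r, t, a, s). t dvd 60 \<and> s \<le> 42) rs"
    have "(d, ?rs) \<in> set (periodic_part cov)"
      using rs(1) \<open>d \<noteq> 1\<close> by (force simp: periodic_part_def)
    moreover have "?F l' ?rs"
    proof -
      have "\<not> (s \<le> l' \<and> l' mod t = a)" if "(r, t, a, s) \<in> set rs" "t dvd 60" "s \<le> 42" for r t a s
      proof -
        have "\<not> (s \<le> l \<and> l mod t = a)" using rs(2) that(1) by (auto simp: list_all_iff)
        moreover have "l mod t = l' mod t"
          using assms(5) that(2) cong_dvd_modulus_nat[of l l' 60 t] by (auto simp: cong_def)
        ultimately show ?thesis using that(3) assms(3) by simp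
      qed
      then show ?thesis by (auto simp: list_all_iff)
    qed
    ultimately show "d \<in> set (sieve (periodic_part cov) l')" unfolding sieve_def by force
  qed
qed

lemma low_part_dvd: "low_part L dvd low_part (L + i)"
  by (induction i) (auto simp: low_part_Suc)

text \<open>The lowest level lies either within the list, where \<open>dead_sound\<close> leaves no
  prime, or beyond it, where the third assumption applies. The search starts at level 1 because
  prime factors of \<open>N\<close> are odd.\<close>

lemma dead_contradiction:
  assumes "dead k As 2 0"
    and "\<And>i. i < length As \<Longrightarrow> distinct (As ! i) \<and> multipliers (Suc i) \<subseteq> set (As ! i)"
    and "\<And>m. length As < m \<Longrightarrow> m \<le> n \<Longrightarrow> low_part m = 1 \<Longrightarrow> multipliers m \<noteq> {} \<Longrightarrow> False"
  shows False
proof -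
  obtain m where m: "0 < m" "m \<le> n" "low_part m = 1" "multipliers m \<noteq> {}"
    by (rule obtain_first_level)
  have "low_part (1 + length As) = 1 \<and> 1 + length As \<le> n"
    using assms(1,2) low_part_1 m(1,2) by (intro dead_sound[of As 1 0]) auto
  then have P: "low_part (1 + length As) = 1" by simp
  have "\<not> m \<le> length As"
  proof
    assume "m \<le> length As"
    then have "low_part (Suc m) dvd low_part (1 + length As)"
      using low_part_dvd[of "Suc m" "length As - m"] by simp
    then have "low_part (Suc m) = 1" using P by simp
    then have *: "(\<Prod>d\<in>multipliers m. 2 ^ m * d + 1) = 1" using low_part_Suc m(3) by simp
    obtain d where d: "d \<in> multipliers m" using m(4) by blast
    then have "2 ^ m * d + 1 dvd (1::nat)"
      using * finite_multipliers dvd_prodI[of "multipliers m" d "\<lambda>d. 2 ^ m * d + 1"] by simp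
    then show False using multipliersD(3)[OF d] by simp
  qed
  then show False using assms(3)[OF _ m(2,3,4)] by simp
qed

text \<open>A single odd divisor at the lowest level violates parity if \<open>m < n\<close>; if
  \<open>m = n\<close>, the factor would be \<open>N\<close> itself, which is not prime.\<close>

lemma singleton_level_empty:
  assumes "multipliers m \<subseteq> {d}" "low_part m = 1" "m \<le> n"
  shows "multipliers m = {}"
proof (rule ccontr)
  assume ne: "multipliers m \<noteq> {}"
  then have md: "multipliers m = {d}" using assms(1) by blast
  then have d: "odd d" using multipliersD(2)[of d m] by simp
  have Q: "low_part (Suc m) = 1 + 2 ^ m * d" using low_part_Suc[of m] assms(2) md by simp
  show False
  proof (cases "m = n")
    case True
    then have "d = k" using Q low_part_Suc_n by (simp add: N_def)
    then show False using top_multiplier md True by simp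
  next
    case False
    then show False using low_part_Suc_even[OF Q] assms(3) d by simp
  qed
qed

lemma eventually_singleton_contradiction:
  assumes "valid_cover k cov" "k > 1" "dead k (map (candidates k cov) [1..<Suc W]) 2 0"
    and "\<And>m. W < m \<Longrightarrow> \<exists>d. multipliers m \<subseteq> {d}"
  shows False
proof (rule dead_contradiction[OF assms(3)])
  fix i assume "i < length (map (candidates k cov) [1..<Suc W])"
  then show "distinct (map (candidates k cov) [1..<Suc W] ! i) \<and>
      multipliers (Suc i) \<subseteq> set (map (candidates k cov) [1..<Suc W] ! i)"
    using candidates_sound[OF assms(1,2), of "Suc i"] by (simp add: nth_append del: upt_Suc)
next
  fix m assume "length (map (candidates k cov) [1..<Suc W]) < m" "m \<le> n" "low_part m = 1" "multipliers m \<noteq> {}"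
  then show False using assms(4)[of m] singleton_level_empty by (auto simp del: upt_Suc)
qed

lemma mod_check_contradiction:
  assumes cov: "valid_cover k cov" and k: "k > 1" "2 * k \<le> 42" and "42 \<le> Suc W"
    and dead: "dead k (map (candidates k cov) [1..<Suc W]) 2 0"
    and check: "mod_check k (map (sieve (periodic_part cov)) [60..<156])"
  shows False
proof (rule dead_contradiction[OF dead])
  fix i assume "i < length (map (candidates k cov) [1..<Suc W])"
  then show "distinct (map (candidates k cov) [1..<Suc W] ! i) \<and>
      multipliers (Suc i) \<subseteq> set (map (candidates k cov) [1..<Suc W] ! i)"
    using candidates_sound[OF cov k(1), of "Suc i"] by (simp add: nth_append del: upt_Suc)
next
  fix m assume "length (map (candidates k cov) [1..<Suc W]) < m" and m: "m \<le> n" "low_part m = 1" "multipliers m \<noteq> {}"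
  then have m42: "42 \<le> m" using assms(4) by simp
  define a where "a = m mod 60"
  define s where "s = (n - m) mod 4"
  define As where "As = take 36 (drop a (map (sieve (periodic_part cov)) [60..<156]))"
  have a: "a < 60" by (simp add: a_def)
  have len: "length As = 36" using a by (simp add: As_def del: upt_rec_numeral)
  \<comment> \<open>Together with \<open>k \<le> 21 < 2 ^ 5\<close> this gives
    \<open>n \<ge> 2 * m - 4\<close>, enough for 36 levels above \<open>m \<ge> 42\<close>.\<close>
  have "2 ^ (2 * m) < (2::nat) ^ n * k" using m m42 by (intro first_level_bound) auto
  also have "\<dots> \<le> 2 ^ n * 2 ^ 5" using k(2) by simp
  also have "\<dots> = 2 ^ (n + 5)" by (simp only: power_add)
  finally have n: "2 * m < n + 5" by simp
  show False
  proof (rule mod_dead_sound[of As s 0 m "2 * m"])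
    show "mod_dead k As s 0"
      using check a unfolding mod_check_def As_def s_def by (auto simp: list_all_iff)
    show "s < 4" by (simp add: s_def)
    show "(m + s) mod 4 = n mod 4" using m(1) by (simp add: s_def mod_simps)
    show "[low_part m = 1 + 2 ^ m * 0] (mod 2 ^ (2 * m))" using m by simp
    show "m + length As \<le> 2 * m" "m + length As \<le> n" using len n m42 by auto
    show "0 \<noteq> (0::nat) \<or> multipliers m \<noteq> {}" using m by simp
    show "distinct (As ! i) \<and> multipliers (m + i) \<subseteq> set (As ! i)" if "i < length As" for i
    proof -
      have "As ! i = sieve (periodic_part cov) (60 + (a + i))"
        using that a len by (simp add: As_def del: upt_rec_numeral)
      moreover have "[m + i = 60 + (a + i)] (mod 60)" by (simp add: cong_def a_def mod_simps)
      ultimately show ?thesis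
        using periodic_part_sound[OF cov k(1), of "m + i" "60 + (a + i)"] k(2) m42 by auto
    qed
    show "n mod 4 = l mod 4" if "m \<le> l" "k \<in> multipliers l" for l
      using order_level_cong[of l k n] multipliersD(4,5)[OF that(2)] level_le_n[OF that(2)]
        odd_k that(1) m42 k(2) by (simp add: N_def)
  qed simp
qed

end

section \<open>The values of k below 27\<close>

lemma not_carmichael_eventually_singleton:
  assumes "valid_cover k cov" "k > 1" "odd k" "dead k (map (candidates k cov) [1..<Suc W]) 2 0"
    and "\<And>m. W < m \<Longrightarrow> \<exists>d. set (candidates k cov m) \<subseteq> {d}"
  shows "\<not> carmichael (2 ^ n * k + 1)"
proof
  assume "carmichael (2 ^ n * k + 1)"
  then interpret carmichael_form k n using assms(3) by unfold_locales
  show False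
  proof (rule eventually_singleton_contradiction[OF assms(1,2,4)])
    fix m assume "W < m"
    then have "multipliers m \<subseteq> set (candidates k cov m)"
      using candidates_sound(2)[OF assms(1,2), of m] by simp
    with assms(5)[OF \<open>W < m\<close>] show "\<exists>d. multipliers m \<subseteq> {d}" by blast
  qed
qed

lemma not_carmichael_mod_check:
  assumes "valid_cover k cov" "k > 1" "2 * k \<le> 42" "odd k" "42 \<le> Suc W"
    and "dead k (map (candidates k cov) [1..<Suc W]) 2 0"
    and "mod_check k (map (sieve (periodic_part cov)) [60..<156])"
  shows "\<not> carmichael (2 ^ n * k + 1)"
proof
  assume "carmichael (2 ^ n * k + 1)"
  then interpret carmichael_form k n using assms(4) by unfold_locales
  show False by (rule mod_check_contradiction[OF assms(1-3,5-7)])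
qed

lemma not_carmichael_1: "\<not> carmichael (2 ^ n * 1 + 1)"
proof
  assume "carmichael (2 ^ n * 1 + 1)"
  then interpret carmichael_form 1 n by unfold_locales simp_all
  obtain m where m: "m \<le> n" "low_part m = 1" "multipliers m \<noteq> {}" by (rule obtain_first_level)
  have "multipliers m \<subseteq> {1}" using multipliersD(1) by auto
  with m show False using singleton_level_empty by blast
qed

lemma upt_from_1: "2 \<le> j \<Longrightarrow> [Suc 0..<j] = 1 # [2..<j]"
  and upt_from_0: "2 \<le> j \<Longrightarrow> [0..<j] = 0 # 1 # [2..<j]"
  by (simp_all add: upt_rec numeral_2_eq_2)

lemmas search_simps = upt_from_0 upt_from_1 valid_cover_def covering_def candidates_def sieve_def
  mod_check_def periodic_part_def

lemma two_power_ge_64: "17 < m \<Longrightarrow> (64::nat) \<le> 2 ^ m"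
  using power_increasing[of 6 m "2::nat"] by simp

text \<open>Validity of the cover forces 1 and \<open>k\<close> to be the only divisors. Above level
  17 the divisor 1 is too large for \<open>fermat_factor_bound\<close>, and by level 17 the search
  has killed every branch with a chosen prime.\<close>

lemma not_carmichael_prime_base:
  assumes "valid_cover k [(1, rs), (k, rs')]" "1 < k" "odd k" "k \<le> 32"
    and "dead k (map (candidates k [(1, rs), (k, rs')]) [1..<Suc 17]) 2 0"
  shows "\<not> carmichael (2 ^ n * k + 1)"
proof (rule not_carmichael_eventually_singleton[OF assms(1-3,5)])
  fix m :: nat assume "17 < m"
  then show "\<exists>d. set (candidates k [(1, rs), (k, rs')] m) \<subseteq> {d}"
    using two_power_ge_64[of m] assms(4) by (intro exI[of _ k]) (auto simp: candidates_def sieve_def)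
qed

section \<open>Prime values of k, and 25\<close>

lemma not_carmichael_3: "\<not> carmichael (2 ^ n * 3 + 1)"
  by (rule not_carmichael_prime_base[of 3 "[(3, 2, 1, 0)]" "[(7, 3, 1, 2)]"]) (simp_all add: search_simps)

lemma not_carmichael_5: "\<not> carmichael (2 ^ n * 5 + 1)"
  by (rule not_carmichael_prime_base[of 5 "[]" "[(3, 2, 0, 0)]"]) (simp_all add: search_simps)

lemma not_carmichael_7: "\<not> carmichael (2 ^ n * 7 + 1)"
  by (rule not_carmichael_prime_base[of 7 "[]" "[(3, 2, 1, 0)]"]) (simp_all add: search_simps)

lemma not_carmichael_11: "\<not> carmichael (2 ^ n * 11 + 1)"
  by (rule not_carmichael_prime_base[of 11 "[(3, 2, 1, 2)]" "[(3, 2, 0, 0)]"]) (simp_all add: search_simps)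

lemma not_carmichael_13: "\<not> carmichael (2 ^ n * 13 + 1)"
  by (rule not_carmichael_prime_base[of 13 "[]" "[(3, 2, 1, 0)]"]) (simp_all add: search_simps)

lemma not_carmichael_17: "\<not> carmichael (2 ^ n * 17 + 1)"
  by (rule not_carmichael_prime_base[of 17 "[(3, 2, 1, 2)]" "[(3, 2, 0, 0)]"]) (simp_all add: search_simps)

lemma not_carmichael_19: "\<not> carmichael (2 ^ n * 19 + 1)"
  by (rule not_carmichael_prime_base[of 19 "[]" "[(3, 2, 1, 0), (5, 4, 0, 0)]"]) (simp_all add: search_simps)

lemma not_carmichael_23: "\<not> carmichael (2 ^ n * 23 + 1)"
  by (rule not_carmichael_prime_base[of 23 "[(3, 2, 1, 2)]" "[(3, 2, 0, 0)]"]) (simp_all add: search_simps)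

lemma not_carmichael_25: "\<not> carmichael (2 ^ n * 25 + 1)"
proof (rule not_carmichael_eventually_singleton)
  let ?cov = "[(1, [(3, 2, 1, 2)]), (5, [(3, 2, 0, 0), (7, 3, 2, 0)]), (25, [(3, 2, 1, 0), (13, 12, 0, 0)])]
    :: cover"
  show "valid_cover 25 ?cov" "dead 25 (map (candidates 25 ?cov) [1..<Suc 17]) 2 0"
    by (simp_all add: search_simps)
  fix m :: nat assume "17 < m"
  then have "1 \<notin> set (candidates 25 ?cov m)"
    using two_power_ge_64[of m] by (simp add: candidates_def)
  \<comment> \<open>Modulo 3 the covering removes the divisor 5 at even levels and 25 at odd
    levels.\<close>
  moreover have "m mod 2 = 0 \<or> m mod 2 = 1" by presburger
  ultimately show "\<exists>d. set (candidates 25 ?cov m) \<subseteq> {d}"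
    by (auto simp: candidates_def sieve_def)
qed simp_all

text \<open>A positive threshold can spare a level where the number equals \<open>r\<close>: 13 is
  \<open>2 ^ 2 * 3 + 1\<close>, so its entry for 3 starts at level 3. The entry of 7 for 3 needs no
  such exception, as 7 never divides \<open>2 ^ j * 9 + 1\<close>.\<close>

definition cover9 :: cover where
  "cover9 =
    [(1, [(3, 2, 1, 0)]),
     (3, [(5, 4, 3, 1), (7, 3, 1, 0), (11, 10, 7, 2), (13, 12, 2, 3), (29, 28, 9, 4)]),
     (9, [(5, 4, 0, 0), (11, 10, 9, 1), (13, 12, 10, 1), (17, 8, 5, 1)])]"

lemma valid_cover9: "valid_cover 9 cover9"
  by (simp add: search_simps cover9_def)

text \<open>The last level, 46 here, must be at least 41 so that the periodic search can take over,
  and such that every branch with a chosen prime has died by then.\<close>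

lemma dead_cover9: "dead 9 (map (candidates 9 cover9) [1..<Suc 46]) 2 0"
  by (simp add: search_simps cover9_def)

lemma mod_check_cover9: "mod_check 9 (map (sieve (periodic_part cover9)) [60..<156])"
  by (simp add: search_simps cover9_def)

lemma not_carmichael_9: "\<not> carmichael (2 ^ n * 9 + 1)"
  by (rule not_carmichael_mod_check[OF valid_cover9 _ _ _ _ dead_cover9 mod_check_cover9]) simp_all

definition cover15 :: cover where
  "cover15 =
    [(1, [(3, 2, 1, 0)]),
     (3, [(5, 4, 3, 0), (7, 3, 1, 0), (11, 10, 7, 2), (13, 12, 2, 3), (19, 18, 14, 3),
        (29, 28, 9, 4), (61, 60, 24, 5), (79, 39, 29, 5)]),
     (5, [(3, 2, 0, 0), (7, 3, 2, 0), (11, 10, 1, 2), (13, 12, 9, 2), (23, 11, 5, 3),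
        (41, 20, 3, 0), (47, 23, 14, 4)]),
     (15, [(11, 10, 3, 0), (13, 12, 5, 0), (17, 8, 7, 1), (23, 11, 8, 1), (31, 5, 1, 2),
        (47, 23, 18, 2), (53, 52, 14, 2), (83, 82, 24, 3)])]"

lemma valid_cover15: "valid_cover 15 cover15"
  by (simp add: search_simps cover15_def)

lemma dead_cover15: "dead 15 (map (candidates 15 cover15) [1..<Suc 41]) 2 0"
  by (simp add: search_simps cover15_def)

lemma mod_check_cover15: "mod_check 15 (map (sieve (periodic_part cover15)) [60..<156])"
  by (simp add: search_simps cover15_def)

lemma not_carmichael_15: "\<not> carmichael (2 ^ n * 15 + 1)"
  by (rule not_carmichael_mod_check[OF valid_cover15 _ _ _ _ dead_cover15 mod_check_cover15]) simp_all

definition cover21 :: cover where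
  "cover21 =
    [(1, [(3, 2, 1, 0)]),
     (3, [(5, 4, 3, 1), (7, 3, 1, 0), (11, 10, 7, 2), (13, 12, 2, 3), (29, 28, 9, 4),
        (61, 60, 24, 5), (67, 66, 60, 5), (97, 48, 5, 0)]),
     (7, [(3, 2, 1, 0), (11, 10, 8, 1), (23, 11, 7, 2), (53, 52, 12, 3), (67, 66, 10, 4),
        (113, 28, 4, 0)]),
     (21, [(5, 4, 2, 0), (11, 10, 0, 0), (13, 12, 3, 0), (19, 18, 8, 0), (23, 11, 10, 1),
        (29, 28, 25, 1), (41, 20, 11, 1), (43, 14, 1, 2), (53, 52, 47, 2),
        (59, 58, 19, 2), (71, 35, 13, 2)])]"

lemma valid_cover21: "valid_cover 21 cover21"
  by (simp add: search_simps cover21_def)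

lemma dead_cover21: "dead 21 (map (candidates 21 cover21) [1..<Suc 63]) 2 0"
  by (simp add: search_simps cover21_def)

lemma mod_check_cover21: "mod_check 21 (map (sieve (periodic_part cover21)) [60..<156])"
  by (simp add: search_simps cover21_def)

lemma not_carmichael_21: "\<not> carmichael (2 ^ n * 21 + 1)"
  by (rule not_carmichael_mod_check[OF valid_cover21 _ _ _ _ dead_cover21 mod_check_cover21]) simp_all

section \<open>The value 27 and the conclusion\<close>

lemma carmichael_1729: "carmichael 1729"
\<comment> \<open>1729 = 7 * 13 * 19 = \<open>2 ^ 6 * 27 + 1\<close>, and 6, 12 and 18 divide
  1728.\<close>
proof (rule carmichaelI[of _ "{7, 13, 19}"])
  show "\<not> prime (1729::nat)"
  proof
    assume "prime (1729::nat)"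
    then have "7 = (1::nat) \<or> 7 = (1729::nat)"
      by (rule prime_nat_iff[THEN iffD1, THEN conjunct2, rule_format]) simp
    then show False by simp
  qed
qed auto

theorem theorem2:
  shows "27 \<in> carmichael_multipliers \<and> (\<forall>k \<in> carmichael_multipliers. 27 \<le> k)"
proof (intro conjI ballI)
  show "27 \<in> carmichael_multipliers"
    using carmichael_1729 by (auto simp: carmichael_multipliers_def intro!: exI[of _ 6])
next
  fix k assume "k \<in> carmichael_multipliers"
  then obtain n where k: "odd k" "carmichael (2 ^ n * k + 1)"
    by (auto simp: carmichael_multipliers_def)
  show "27 \<le> k"
  proof (rule ccontr)
    assume "\<not> 27 \<le> k"
    then have "k < 27" by simp
    with k(1) have "k \<in> {1, 3, 5, 7, 9, 11, 13, 15, 17, 19, 21, 23, 25}"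
      unfolding insert_iff empty_iff by presburger
    with k(2) show False
      using not_carmichael_1[of n] not_carmichael_3[of n] not_carmichael_5[of n] not_carmichael_7[of n]
        not_carmichael_9[of n] not_carmichael_11[of n] not_carmichael_13[of n] not_carmichael_15[of n]
        not_carmichael_17[of n] not_carmichael_19[of n] not_carmichael_21[of n] not_carmichael_23[of n]
        not_carmichael_25[of n]
      unfolding insert_iff empty_iff by blast
  qed
qed

end
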